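(* Work in the system s-NSA described in the context. Let $\psi(n,m)$ be a $\Delta_0$-formula and $\omega\in\Omega$ such that $\psi(n,\omega)$ is $\Omega$-invariant. Then \[ (\forall n\in \mathbb{N})(\exists m_{0}\in \mathbb{N})(\forall m,m'\in {}^{*}\mathbb{N})[m,m'\geq m_{0}\rightarrow (\psi(n,m)\leftrightarrow \psi(n,m'))]. \] Likewise, for every function $f:\mathbb{N}\times\mathbb{N}\to\mathbb{N}$ and $\omega\in\Omega$ such that $f(n,\omega)$ is $\Omega$-invariant, \[ (\forall n\in \mathbb{N})(\exists m_{0}\in \mathbb{N})(\forall m,m'\in {}^{*}\mathbb{N})[m,m'\geq m_{0}\rightarrow f(n,m)= f(n,m')]. \] Moreover, in each case the number $m_0$ (as a function of $n$) is computed by an $\Omega$-invariant function.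
   Context: $\mathbb{N}=\{0,1,2,\dots\}$ is the set of standard (finite) natural numbers, ${}^{*}\mathbb{N}\supseteq\mathbb{N}$ its nonstandard extension (hypernatural numbers), and $\Omega={}^{*}\mathbb{N}\setminus\mathbb{N}$ the set of infinite numbers. For a formula $\varphi$, ${}^{*}\varphi$ is its image under the star map (the star is often suppressed, e.g. $f(n,\omega)$ means ${}^{*}f(n,\omega)$). A formula is $\Delta_0$ (bounded) if all its quantifiers are bounded by terms and no infinite numbers occur in it; $\Delta_0$-formulas may contain standard numbers and standard sets as parameters. The system s-NSA is multi-sorted, with sorts for standard numbers (ranging over $\mathbb{N}$), nonstandard numbers (ranging over ${}^{*}\mathbb{N}$), standard sets (subsets of $\mathbb{N}$) and nonstandard sets (subsets of ${}^{*}\mathbb{N}$), with axioms: (1) $I\Sigma_1$ and ${}^{*}I\Sigma_1$; (2) ${}^{*}\mathbb{N}$ is an end extension of $\mathbb{N}$; (3) the standard structure is embedded in the nonstandard one via an injective homomorphism; (4) $\Omega$-CA: for $\Delta_0$ $\psi(n,m)$ and $\omega\in\Omega$, if $(\forall n\in\mathbb{N})(\forall\omega'\in\Omega)[{}^{*}\psi(n,\omega)\leftrightarrow{}^{*}\psi(n,\omega')]$ then $(\exists X\subset\mathbb{N})(\forall n\in\mathbb{N})[{}^{*}\psi(n,\omega)\leftrightarrow n\in X]$; (5) $\Delta_0$-TRANS: $(\forall n\in\mathbb{N})(\forall X\subset\mathbb{N})[\varphi(n,X)\leftrightarrow{}^{*}\varphi(n,X)]$ for $\Delta_0$ $\varphi$;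 (6) $\Delta_0$-underspill: $(\forall n\in\mathbb{N})(\forall X\subset{}^{*}\mathbb{N})[(\forall\omega\in\Omega){}^{*}\varphi(n,X,\omega)\rightarrow(\exists m\in\mathbb{N})\varphi(n,X,m)]$ for $\Delta_0$ $\varphi$. It also satisfies the transfer rule: if s-NSA proves $(\forall n\in\mathbb{N})\varphi(n)$ for $\Delta_0$ $\varphi$, then it proves $(\forall n\in{}^{*}\mathbb{N}){}^{*}\varphi(n)$. $\Omega$-invariance: for $\Delta_0$ $\psi(n,m)$ and fixed $\omega\in\Omega$, the formula $\psi(n,\omega)$ is $\Omega$-invariant if $(\forall n\in\mathbb{N})(\forall\omega'\in\Omega)(\psi(n,\omega)\leftrightarrow\psi(n,\omega'))$. For $f:\mathbb{N}\times\mathbb{N}\to\mathbb{N}$, $f(n,\omega)$ is $\Omega$-invariant if $(\forall n\in\mathbb{N})(\forall\omega'\in\Omega)(f(n,\omega)=f(n,\omega'))$. *)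

theory Defs
  imports Main
begin

text \<open>
  A statement proved in s-NSA is rendered as a statement about all models of s-NSA, with Henkin
  semantics for the set sorts: \<open>fam\<close> is the family of subsets of the number domain over which the
  set sort ranges. Neither number sort is assumed to be the type \<^typ>\<open>nat\<close>.
\<close>

record 'a l2_structure =
  zero :: 'a
  one :: 'a
  add :: "'a \<Rightarrow> 'a \<Rightarrow> 'a"
  mul :: "'a \<Rightarrow> 'a \<Rightarrow> 'a"
  less :: "'a \<Rightarrow> 'a \<Rightarrow> bool"
  fam :: "'a set set"

definition leq :: "'a l2_structure \<Rightarrow> 'a \<Rightarrow> 'a \<Rightarrow> bool" where
  "leq A a b \<longleftrightarrow> less A a b \<or> a = b"

datatype tm = Var nat | Zero | One | Add tm tm | Mul tm tm

text \<open>
  \<open>\<Delta>\<^sub>0\<close>-formulas: \<open>In t i\<close> is membership in the \<open>i\<close>-th set variable and \<open>BAll x t \<phi>\<close> is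
  \<open>(\<forall>x < t) \<phi>\<close>, where \<open>t\<close> is evaluated outside the scope of \<open>x\<close>. The other connectives and the
  bounded existential quantifier are classically definable.
\<close>

datatype fm = Eq tm tm | Lt tm tm | In tm nat | Neg fm | Conj fm fm | BAll nat tm fm

primrec eval :: "'a l2_structure \<Rightarrow> (nat \<Rightarrow> 'a) \<Rightarrow> tm \<Rightarrow> 'a" where
  "eval A e (Var x) = e x"
| "eval A e Zero = zero A"
| "eval A e One = one A"
| "eval A e (Add s t) = add A (eval A e s) (eval A e t)"
| "eval A e (Mul s t) = mul A (eval A e s) (eval A e t)"

primrec sat :: "'a l2_structure \<Rightarrow> (nat \<Rightarrow> 'a) \<Rightarrow> (nat \<Rightarrow> 'a set) \<Rightarrow> fm \<Rightarrow> bool" where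
  "sat A e E (Eq s t) \<longleftrightarrow> eval A e s = eval A e t"
| "sat A e E (Lt s t) \<longleftrightarrow> less A (eval A e s) (eval A e t)"
| "sat A e E (In t i) \<longleftrightarrow> eval A e t \<in> E i"
| "sat A e E (Neg \<phi>) \<longleftrightarrow> \<not> sat A e E \<phi>"
| "sat A e E (Conj \<phi> \<psi>) \<longleftrightarrow> sat A e E \<phi> \<and> sat A e E \<psi>"
| "sat A e E (BAll x t \<phi>) \<longleftrightarrow> (\<forall>a. less A a (eval A e t) \<longrightarrow> sat A (e(x := a)) E \<phi>)"

text \<open>
  \<open>I\<Sigma>\<^sub>1\<close> in the language with sets: the basic axioms of second-order arithmetic, and induction for
  formulas \<open>\<exists>y \<theta>\<close> with \<open>\<theta>\<close> in \<open>\<Delta>\<^sub>0\<close> and arbitrary number and set parameters.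
\<close>

definition basic_axioms :: "'a l2_structure \<Rightarrow> bool" where
  "basic_axioms A \<longleftrightarrow>
     (\<forall>m. add A m (one A) \<noteq> zero A) \<and>
     (\<forall>m n. add A m (one A) = add A n (one A) \<longrightarrow> m = n) \<and>
     (\<forall>m. add A m (zero A) = m) \<and>
     (\<forall>m n. add A m (add A n (one A)) = add A (add A m n) (one A)) \<and>
     (\<forall>m. mul A m (zero A) = zero A) \<and>
     (\<forall>m n. mul A m (add A n (one A)) = add A (mul A m n) m) \<and>
     (\<forall>m. \<not> less A m (zero A)) \<and>
     (\<forall>m n. less A m (add A n (one A)) \<longleftrightarrow> less A m n \<or> m = n)"

definition Sigma1_induction :: "'a l2_structure \<Rightarrow> bool" where
  "Sigma1_induction A \<longleftrightarrow>
     (\<forall>\<theta> x y e E.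
        (\<forall>i. E i \<in> fam A) \<longrightarrow>
        (\<exists>b. sat A (e(x := zero A, y := b)) E \<theta>) \<longrightarrow>
        (\<forall>a. (\<exists>b. sat A (e(x := a, y := b)) E \<theta>) \<longrightarrow>
              (\<exists>b. sat A (e(x := add A a (one A), y := b)) E \<theta>)) \<longrightarrow>
        (\<forall>a. \<exists>b. sat A (e(x := a, y := b)) E \<theta>))"

text \<open>Nonemptiness of \<open>fam\<close> is the usual convention that no sort is empty.\<close>

definition I_Sigma1 :: "'a l2_structure \<Rightarrow> bool" where
  "I_Sigma1 A \<longleftrightarrow> fam A \<noteq> {} \<and> basic_axioms A \<and> Sigma1_induction A"

record ('a, 'b) nsa_structure =
  std :: "'a l2_structure"
  nst :: "'b l2_structure"
  star :: "'a \<Rightarrow> 'b"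
  starS :: "'a set \<Rightarrow> 'b set"

definition Omega :: "('a, 'b) nsa_structure \<Rightarrow> 'b set" where
  "Omega M = - range (star M)"

definition std_sets :: "('a, 'b) nsa_structure \<Rightarrow> (nat \<Rightarrow> 'a set) \<Rightarrow> bool" where
  "std_sets M E \<longleftrightarrow> (\<forall>i. E i \<in> fam (std M))"

text \<open>
  In a formula \<open>\<psi>(n,m)\<close> the variables 0 and 1 stand for \<open>n\<close> and \<open>m\<close>; all other number variables
  and all set variables are parameters, with standard values given by \<open>e\<close> and \<open>E\<close>.
\<close>

definition star_sat2 ::
  "('a, 'b) nsa_structure \<Rightarrow> fm \<Rightarrow> (nat \<Rightarrow> 'a) \<Rightarrow> (nat \<Rightarrow> 'a set) \<Rightarrow> 'b \<Rightarrow> 'b \<Rightarrow> bool" where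
  "star_sat2 M \<psi> e E a b \<longleftrightarrow>
     sat (nst M) ((star M \<circ> e)(0 := a, 1 := b)) (starS M \<circ> E) \<psi>"

definition Omega_invariant ::
  "('a, 'b) nsa_structure \<Rightarrow> fm \<Rightarrow> (nat \<Rightarrow> 'a) \<Rightarrow> (nat \<Rightarrow> 'a set) \<Rightarrow> 'b \<Rightarrow> bool" where
  "Omega_invariant M \<psi> e E \<omega> \<longleftrightarrow>
     (\<forall>n. \<forall>\<omega>'\<in>Omega M. star_sat2 M \<psi> e E (star M n) \<omega> \<longleftrightarrow> star_sat2 M \<psi> e E (star M n) \<omega>')"

definition end_extension :: "('a, 'b) nsa_structure \<Rightarrow> bool" where
  "end_extension M \<longleftrightarrow> (\<forall>n a. less (nst M) a (star M n) \<longrightarrow> a \<in> range (star M))"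

definition embedding :: "('a, 'b) nsa_structure \<Rightarrow> bool" where
  "embedding M \<longleftrightarrow>
     inj (star M) \<and>
     star M (zero (std M)) = zero (nst M) \<and>
     star M (one (std M)) = one (nst M) \<and>
     (\<forall>m n. star M (add (std M) m n) = add (nst M) (star M m) (star M n)) \<and>
     (\<forall>m n. star M (mul (std M) m n) = mul (nst M) (star M m) (star M n)) \<and>
     (\<forall>m n. less (std M) m n \<longleftrightarrow> less (nst M) (star M m) (star M n)) \<and>
     inj_on (starS M) (fam (std M)) \<and>
     (\<forall>X\<in>fam (std M). starS M X \<in> fam (nst M)) \<and>
     (\<forall>n. \<forall>X\<in>fam (std M). n \<in> X \<longleftrightarrow> star M n \<in> starS M X)"

definition Omega_CA :: "('a, 'b) nsa_structure \<Rightarrow> bool" where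
  "Omega_CA M \<longleftrightarrow>
     (\<forall>\<psi> e E. \<forall>\<omega>\<in>Omega M. std_sets M E \<longrightarrow> Omega_invariant M \<psi> e E \<omega> \<longrightarrow>
        (\<exists>X\<in>fam (std M). \<forall>n. star_sat2 M \<psi> e E (star M n) \<omega> \<longleftrightarrow> n \<in> X))"

definition Delta0_TRANS :: "('a, 'b) nsa_structure \<Rightarrow> bool" where
  "Delta0_TRANS M \<longleftrightarrow>
     (\<forall>\<phi> e E. std_sets M E \<longrightarrow>
        (sat (std M) e E \<phi> \<longleftrightarrow> sat (nst M) (star M \<circ> e) (starS M \<circ> E) \<phi>))"

definition Delta0_underspill :: "('a, 'b) nsa_structure \<Rightarrow> bool" where
  "Delta0_underspill M \<longleftrightarrow>
     (\<forall>\<phi> x i e E. \<forall>X\<in>fam (nst M). std_sets M E \<longrightarrow>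
        (\<forall>\<omega>\<in>Omega M. sat (nst M) ((star M \<circ> e)(x := \<omega>)) ((starS M \<circ> E)(i := X)) \<phi>) \<longrightarrow>
        (\<exists>m. sat (nst M) ((star M \<circ> e)(x := star M m)) ((starS M \<circ> E)(i := X)) \<phi>))"

definition s_NSA :: "('a, 'b) nsa_structure \<Rightarrow> bool" where
  "s_NSA M \<longleftrightarrow>
     I_Sigma1 (std M) \<and> I_Sigma1 (nst M) \<and> end_extension M \<and> embedding M \<and>
     Omega_CA M \<and> Delta0_TRANS M \<and> Delta0_underspill M"

text \<open>
  A function \<open>f : \<nat> \<times> \<nat> \<rightarrow> \<nat>\<close> is given by a \<open>\<Delta>\<^sub>0\<close>-formula \<open>\<phi>(n,m,k)\<close> with standard parameters
  (variables 0, 1, 2) defining its graph; a function coded by a standard set \<open>F\<close> is the case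
  \<open>\<langle>n,m,k\<rangle> \<in> F\<close>. As s-NSA has no transfer for unbounded formulas, \<open>\<phi>\<close> being a graph over the
  standard numbers does not force its star image to be single-valued or total over the nonstandard
  ones. Therefore the value of the starred function is the least one permitted by the starred graph
  (so the unique one, wherever it is unique), and an equation between values asserts in particular
  that both sides are defined.
\<close>

definition std_function ::
  "('a, 'b) nsa_structure \<Rightarrow> fm \<Rightarrow> (nat \<Rightarrow> 'a) \<Rightarrow> (nat \<Rightarrow> 'a set) \<Rightarrow> bool" where
  "std_function M \<phi> e E \<longleftrightarrow>
     std_sets M E \<and> (\<forall>n m. \<exists>!k. sat (std M) (e(0 := n, 1 := m, 2 := k)) E \<phi>)"

definition star_sat3 ::
  "('a, 'b) nsa_structure \<Rightarrow> fm \<Rightarrow> (nat \<Rightarrow> 'a) \<Rightarrow> (nat \<Rightarrow> 'a set) \<Rightarrow> 'b \<Rightarrow> 'b \<Rightarrow> 'b \<Rightarrow> bool" where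
  "star_sat3 M \<phi> e E a b c \<longleftrightarrow>
     sat (nst M) ((star M \<circ> e)(0 := a, 1 := b, 2 := c)) (starS M \<circ> E) \<phi>"

definition star_value ::
  "('a, 'b) nsa_structure \<Rightarrow> fm \<Rightarrow> (nat \<Rightarrow> 'a) \<Rightarrow> (nat \<Rightarrow> 'a set) \<Rightarrow> 'b \<Rightarrow> 'b \<Rightarrow> 'b \<Rightarrow> bool" where
  "star_value M \<phi> e E a b c \<longleftrightarrow>
     star_sat3 M \<phi> e E a b c \<and> (\<forall>c'. less (nst M) c' c \<longrightarrow> \<not> star_sat3 M \<phi> e E a b c')"

definition star_value_eq ::
  "('a, 'b) nsa_structure \<Rightarrow> fm \<Rightarrow> (nat \<Rightarrow> 'a) \<Rightarrow> (nat \<Rightarrow> 'a set) \<Rightarrow> 'b \<Rightarrow> 'b \<Rightarrow> 'b \<Rightarrow> bool" where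
  "star_value_eq M \<phi> e E a b b' \<longleftrightarrow>
     (\<exists>c. star_value M \<phi> e E a b c \<and> star_value M \<phi> e E a b' c)"

definition Omega_invariant_function ::
  "('a, 'b) nsa_structure \<Rightarrow> fm \<Rightarrow> (nat \<Rightarrow> 'a) \<Rightarrow> (nat \<Rightarrow> 'a set) \<Rightarrow> 'b \<Rightarrow> bool" where
  "Omega_invariant_function M \<phi> e E \<omega> \<longleftrightarrow>
     (\<forall>n. \<forall>\<omega>'\<in>Omega M. star_value_eq M \<phi> e E (star M n) \<omega> \<omega>')"

end

theory Submission
  imports Defs
begin

text \<open>
  An \<open>\<Omega>\<close>-invariant value \<open>c\<close> of \<open>f(n,\<cdot>)\<close> is taken at every infinite argument. For fixed infinite
  \<open>\<omega>\<close>, the set of \<open>x\<close> such that \<open>f(n,j) = c\<close> for all \<open>j\<close> with \<open>x \<le> j < \<omega>\<close> is \<open>\<Delta>\<^sub>0\<close> with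
  parameters and contains every infinite number; induction in the nonstandard structure shows that
  it contains a standard one, since otherwise its complement would be a \<open>\<Delta>\<^sub>0\<close> copy of the standard
  cut. In particular \<open>c\<close> is a value of \<open>f\<close> at standard arguments, hence is standard. As \<open>c\<close> then lies
  below every infinite number, the least point of stability is defined by a \<open>\<Delta>\<^sub>0\<close>-formula in which
  \<open>c\<close> is bounded by the second argument, and this definition does not depend on \<open>\<omega>\<close>.
  The statement for formulas is the one for their characteristic functions.
\<close>

section \<open>Renaming of variables\<close>

primrec rename_tm :: "(nat \<Rightarrow> nat) \<Rightarrow> tm \<Rightarrow> tm" where
  "rename_tm f (Var x) = Var (f x)"
| "rename_tm f Zero = Zero"
| "rename_tm f One = One"
| "rename_tm f (Add s t) = Add (rename_tm f s) (rename_tm f t)"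
| "rename_tm f (Mul s t) = Mul (rename_tm f s) (rename_tm f t)"

primrec rename_fm :: "(nat \<Rightarrow> nat) \<Rightarrow> fm \<Rightarrow> fm" where
  "rename_fm f (Eq s t) = Eq (rename_tm f s) (rename_tm f t)"
| "rename_fm f (Lt s t) = Lt (rename_tm f s) (rename_tm f t)"
| "rename_fm f (In t i) = In (rename_tm f t) i"
| "rename_fm f (Neg \<phi>) = Neg (rename_fm f \<phi>)"
| "rename_fm f (Conj \<phi> \<psi>) = Conj (rename_fm f \<phi>) (rename_fm f \<psi>)"
| "rename_fm f (BAll x t \<phi>) = BAll (f x) (rename_tm f t) (rename_fm f \<phi>)"

lemma eval_rename_tm: "eval A e (rename_tm f t) = eval A (e \<circ> f) t"
  by (induction t) auto

lemma sat_rename_fm: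
  assumes "inj f"
  shows "sat A e E (rename_fm f \<phi>) \<longleftrightarrow> sat A (e \<circ> f) E \<phi>"
proof (induction \<phi> arbitrary: e)
  case (BAll x t \<phi>)
  have "e(f x := a) \<circ> f = (e \<circ> f)(x := a)" for a
    using assms by (auto simp: inj_def)
  then show ?case by (simp only: rename_fm.simps sat.simps BAll eval_rename_tm)
qed (auto simp: eval_rename_tm)

text \<open>Vacates variable 2, so that a new number can be put there without disturbing a parameter
  or the value of a function, which moves to variable 3.\<close>

definition skip2 :: "nat \<Rightarrow> nat" where
  "skip2 x = (if x < 2 then x else Suc x)"

definition unskip2 :: "nat \<Rightarrow> nat" where
  "unskip2 x = (if x < 2 then x else x - 1)"

lemma sat_rename_skip2:
  "sat A ((e \<circ> unskip2)(0 := a, 1 := b, 2 := c, 3 := d)) E (rename_fm skip2 \<phi>) \<longleftrightarrow>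
   sat A (e(0 := a, 1 := b, 2 := d)) E \<phi>" (is ?with3)
  "sat A ((e \<circ> unskip2)(0 := a, 1 := b, 2 := c)) E (rename_fm skip2 \<phi>) \<longleftrightarrow>
   sat A (e(0 := a, 1 := b)) E \<phi>" (is ?without3)
proof -
  have inj: "inj skip2"
    by (auto simp: inj_def skip2_def split: if_splits)
  have "(e \<circ> unskip2)(0 := a, 1 := b, 2 := c, 3 := d) \<circ> skip2 = e(0 := a, 1 := b, 2 := d)"
    by (auto simp: skip2_def unskip2_def)
  then show ?with3
    by (simp only: sat_rename_fm[OF inj])
  have "(e \<circ> unskip2)(0 := a, 1 := b, 2 := c) \<circ> skip2 = e(0 := a, 1 := b)"
    by (auto simp: skip2_def unskip2_def)
  then show ?without3
    by (simp only: sat_rename_fm[OF inj])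
qed

section \<open>Induction and order\<close>

text \<open>The bound \<open>Var x\<close> is evaluated before \<open>x\<close> is rebound, so the
  candidate and its smaller competitors can share one variable and no fresh one is needed.\<close>

definition Least_fm :: "nat \<Rightarrow> fm \<Rightarrow> fm" where
  "Least_fm x \<phi> = Conj \<phi> (BAll x (Var x) (Neg \<phi>))"

lemma sat_Least_fm:
  "sat A e E (Least_fm x \<phi>) \<longleftrightarrow>
   sat A e E \<phi> \<and> (\<forall>a. less A a (e x) \<longrightarrow> \<not> sat A (e(x := a)) E \<phi>)"
  by (simp add: Least_fm_def)

locale arithmetic =
  fixes A :: "'a l2_structure"
  assumes I_Sigma1: "I_Sigma1 A"
begin

abbreviation less_A (infix \<open>\<sqsubset>\<close> 50) where "a \<sqsubset> b \<equiv> less A a b"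
abbreviation succ where "succ a \<equiv> add A a (one A)"

lemma not_less_zero: "\<not> a \<sqsubset> zero A"
  and less_succ_iff: "a \<sqsubset> succ b \<longleftrightarrow> a \<sqsubset> b \<or> a = b"
  and succ_neq_zero: "succ a \<noteq> zero A"
  and add_zero: "add A a (zero A) = a"
  using I_Sigma1 unfolding I_Sigma1_def basic_axioms_def by blast+

lemma one_neq_zero: "one A \<noteq> zero A"
  using succ_neq_zero[of "zero A"] add_zero by auto

text \<open>The axiom is about formulas with an unbounded existential witness. Shifting all
  variables by \<open>Suc\<close> frees variable 0 for a witness on which the formula does not
  depend.\<close>

lemma Delta0_induct:
  assumes E: "\<And>i. E i \<in> fam A"
    and "sat A (e(x := zero A)) E \<theta>"
    and "\<And>a. sat A (e(x := a)) E \<theta> \<Longrightarrow> sat A (e(x := succ a)) E \<theta>"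
  shows "sat A (e(x := a)) E \<theta>"
proof -
  define e' where "e' = case_nat undefined e"
  have "e'(Suc x := a, 0 := b) \<circ> Suc = e(x := a)" for a b
    by (auto simp: e'_def)
  then have shift: "sat A (e'(Suc x := a, 0 := b)) E (rename_fm Suc \<theta>) \<longleftrightarrow> sat A (e(x := a)) E \<theta>"
    for a b
    by (simp add: sat_rename_fm)
  have "Sigma1_induction A" using I_Sigma1 by (simp add: I_Sigma1_def)
  from this[unfolded Sigma1_induction_def, THEN spec[of _ "rename_fm Suc \<theta>"],
      THEN spec[of _ "Suc x"], THEN spec[of _ 0], THEN spec[of _ e'], THEN spec[of _ E]]
  show ?thesis using assms by (simp only: shift) simp
qed

lemma set_free_induct:
  assumes "\<And>a E. sat A (e(x := a)) E \<theta> \<longleftrightarrow> P a"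
    and "P (zero A)" and "\<And>a. P a \<Longrightarrow> P (succ a)"
  shows "P a"
proof -
  obtain X where "X \<in> fam A" using I_Sigma1 by (auto simp: I_Sigma1_def)
  then show ?thesis
    using Delta0_induct[of "\<lambda>_. X" e x \<theta>] assms by auto
qed

lemma less_trans: "a \<sqsubset> c" if "a \<sqsubset> b" "b \<sqsubset> c"
proof -
  \<comment> \<open>Induction on \<open>c\<close>, held by variable 2; in the successor step the new
    case \<open>b = c\<close> is the assumption on \<open>a\<close> and \<open>b\<close>.\<close>
  have "b \<sqsubset> c \<longrightarrow> a \<sqsubset> c"
    by (rule set_free_induct[where x = 2 and e = "\<lambda>i. if i = 0 then a else b"
          and \<theta> = "Neg (Conj (Lt (Var 1) (Var 2)) (Neg (Lt (Var 0) (Var 2))))"])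
      (use that(1) in \<open>auto simp: not_less_zero less_succ_iff\<close>)
  then show ?thesis using that by simp
qed

lemma less_irrefl: "\<not> a \<sqsubset> a"
proof (rule set_free_induct[where x = 0 and \<theta> = "Neg (Lt (Var 0) (Var 0))"])
  show "\<not> succ a \<sqsubset> succ a" if "\<not> a \<sqsubset> a" for a
    using that less_succ_iff less_trans by metis
qed (auto simp: not_less_zero)

lemma zero_least: "zero A = a \<or> zero A \<sqsubset> a"
  by (rule set_free_induct[where x = 0
        and \<theta> = "Neg (Conj (Neg (Eq Zero (Var 0))) (Neg (Lt Zero (Var 0))))"])
    (auto simp: less_succ_iff)

lemma succ_leI: "succ a \<sqsubset> b \<or> succ a = b" if "a \<sqsubset> b"
proof -
  have "a \<sqsubset> b \<longrightarrow> succ a \<sqsubset> b \<or> succ a = b"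
    by (rule set_free_induct[where x = 1 and e = "\<lambda>_. a"
          and \<theta> = "Neg (Conj (Lt (Var 0) (Var 1)) (Conj (Neg (Lt (Add (Var 0) One) (Var 1)))
            (Neg (Eq (Add (Var 0) One) (Var 1)))))"])
      (auto simp: not_less_zero less_succ_iff)
  then show ?thesis using that by simp
qed

lemma less_linear: "a \<sqsubset> b \<or> a = b \<or> b \<sqsubset> a"
proof (rule set_free_induct[where x = 0 and e = "\<lambda>_. b"
      and \<theta> = "Neg (Conj (Neg (Lt (Var 0) (Var 1)))
        (Conj (Neg (Eq (Var 0) (Var 1))) (Neg (Lt (Var 1) (Var 0)))))"])
  show "succ a \<sqsubset> b \<or> succ a = b \<or> b \<sqsubset> succ a" if "a \<sqsubset> b \<or> a = b \<or> b \<sqsubset> a" for a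
    using that succ_leI less_succ_iff by blast
qed (use zero_least in auto)

lemma Delta0_least:
  assumes E: "\<And>i. E i \<in> fam A" and a: "sat A (e(x := a)) E \<theta>"
  obtains b where "sat A (e(x := b)) E \<theta>" "\<And>c. c \<sqsubset> b \<Longrightarrow> \<not> sat A (e(x := c)) E \<theta>"
proof -
  have "\<exists>b. sat A (e(x := b)) E \<theta> \<and> (\<forall>c. c \<sqsubset> b \<longrightarrow> \<not> sat A (e(x := c)) E \<theta>)"
  proof (rule ccontr)
    assume none: "\<not> ?thesis"
    \<comment> \<open>Course-of-values induction: the induction formula speaks of everything below
      its argument, and is taken at \<open>succ a\<close> so that \<open>a\<close> itself is
      covered.\<close>
    have "sat A (e(x := succ a)) E (BAll x (Var x) (Neg \<theta>))"
    proof (rule Delta0_induct[OF E])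
      show "sat A (e(x := succ a)) E (BAll x (Var x) (Neg \<theta>))"
        if "sat A (e(x := a)) E (BAll x (Var x) (Neg \<theta>))" for a
        using that none by (simp add: less_succ_iff) blast
    qed (simp add: not_less_zero)
    with a show False by (simp add: less_succ_iff) blast
  qed
  with that show thesis by blast
qed

lemma Least_fm_unique:
  assumes "sat A (e(x := a)) E (Least_fm x \<phi>)" "sat A (e(x := b)) E (Least_fm x \<phi>)"
  shows "a = b"
  using assms less_linear[of a b] by (auto simp: sat_Least_fm)

end

section \<open>The modulus of stability\<close>

text \<open>With \<open>V(n,m,c)\<close> for \<open>f(n,m) = c\<close>, the variables 0, 1, 2, 3 stand for \<open>n\<close>, \<open>m\<close>, \<open>k\<close>, \<open>c\<close>;
  rebinding variable 1 replaces \<open>m\<close> by \<open>j\<close> without a substitution.\<close>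

definition constant_fm :: "fm \<Rightarrow> fm" where
  "constant_fm V = BAll 1 (Var 1) (Neg (Conj (Neg (Lt (Var 1) (Var 2))) (Neg V)))"

text \<open>The premise \<open>k < m\<close> makes \<open>k = m\<close> admissible, so that the least \<open>k\<close> is defined everywhere.\<close>

definition settled_fm :: "fm \<Rightarrow> fm" where
  "settled_fm V = Neg (Conj (Lt (Var 2) (Var 1))
     (BAll 3 (Var 1) (Neg (Conj V (constant_fm V)))))"

text \<open>The inner \<open>Least_fm\<close> makes the graph single-valued over the nonstandard
  numbers too, matching \<open>star_value\<close>; the outer one selects the least point of
  stability.\<close>

definition modulus_fm :: "fm \<Rightarrow> fm" where
  "modulus_fm \<phi> = Least_fm 2 (settled_fm (rename_fm skip2 (Least_fm 2 \<phi>)))"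

lemma sat_constant_fm:
  "sat A ((e \<circ> unskip2)(0 := n, 1 := m, 2 := k, 3 := c)) E (constant_fm (rename_fm skip2 \<phi>)) \<longleftrightarrow>
   (\<forall>j. less A j m \<longrightarrow> \<not> less A j k \<longrightarrow> sat A (e(0 := n, 1 := j, 2 := c)) E \<phi>)"
proof -
  have "(e \<circ> unskip2)(0 := n, 1 := m, 2 := k, 3 := c, 1 := j) =
    (e \<circ> unskip2)(0 := n, 1 := j, 2 := k, 3 := c)" for j
    by auto
  then show ?thesis
    unfolding constant_fm_def sat.simps eval.simps by (simp only: sat_rename_skip2) auto
qed

lemma sat_settled_fm:
  "sat A ((e \<circ> unskip2)(0 := n, 1 := m, 2 := k)) E (settled_fm (rename_fm skip2 \<phi>)) \<longleftrightarrow>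
   (less A k m \<longrightarrow> (\<exists>c. less A c m \<and> sat A (e(0 := n, 1 := m, 2 := c)) E \<phi> \<and>
     (\<forall>j. less A j m \<longrightarrow> \<not> less A j k \<longrightarrow> sat A (e(0 := n, 1 := j, 2 := c)) E \<phi>)))"
  unfolding settled_fm_def sat.simps sat_constant_fm sat_rename_skip2 by auto

lemma star_value_iff:
  "star_value M \<phi> e E a b c \<longleftrightarrow>
   sat (nst M) ((star M \<circ> e)(0 := a, 1 := b, 2 := c)) (starS M \<circ> E) (Least_fm 2 \<phi>)"
  by (simp add: star_value_def star_sat3_def sat_Least_fm)

locale nsa_model =
  fixes M :: "('a, 'b) nsa_structure"
  assumes s_NSA: "s_NSA M"
begin

sublocale S: arithmetic "std M"
  using s_NSA by unfold_locales (simp add: s_NSA_def)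

sublocale N: arithmetic "nst M"
  using s_NSA by unfold_locales (simp add: s_NSA_def)

notation N.less_A (infix \<open>\<sqsubset>\<close> 50)

lemma starS_fam: "std_sets M E \<Longrightarrow> (starS M \<circ> E) i \<in> fam (nst M)"
  using s_NSA by (auto simp: s_NSA_def embedding_def std_sets_def)

lemma star_succ: "star M (S.succ n) = N.succ (star M n)"
  and star_zero: "star M (zero (std M)) = zero (nst M)"
  using s_NSA by (auto simp: s_NSA_def embedding_def)

lemma less_starE:
  assumes "a \<sqsubset> star M n" obtains m where "a = star M m"
  using assms s_NSA by (auto simp: s_NSA_def end_extension_def)

lemma star_less_Omega: "star M n \<sqsubset> \<omega>" if "\<omega> \<in> Omega M"
  using that N.less_linear[of "star M n" \<omega>] by (auto simp: Omega_def elim: less_starE)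

text \<open>Every number is below a given infinite one or itself infinite. This lets claims about
  all arguments be checked below one infinite bound.\<close>

lemma not_less_Omega: "a \<in> Omega M" if "\<omega> \<in> Omega M" "\<not> a \<sqsubset> \<omega>"
  using that star_less_Omega by (auto simp: Omega_def)

lemma transfer:
  "std_sets M E \<Longrightarrow> sat (std M) e E \<phi> \<longleftrightarrow> sat (nst M) (star M \<circ> e) (starS M \<circ> E) \<phi>"
  using s_NSA unfolding s_NSA_def Delta0_TRANS_def by blast

text \<open>Unlike the underspill axiom, this allows infinite number parameters in \<open>e\<close>.\<close>

lemma underspill:
  assumes E: "\<And>i. E i \<in> fam (nst M)" and "\<omega> \<in> Omega M"
    and inf: "\<And>\<omega>. \<omega> \<in> Omega M \<Longrightarrow> sat (nst M) (e(x := \<omega>)) E \<theta>"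
  shows "\<exists>m. sat (nst M) (e(x := star M m)) E \<theta>"
proof (rule ccontr)
  assume none: "\<not> ?thesis"
  have "sat (nst M) (e(x := \<omega>)) E (Neg \<theta>)"
  proof (rule N.Delta0_induct[OF E])
    show "sat (nst M) (e(x := zero (nst M))) E (Neg \<theta>)"
      using none by (simp flip: star_zero)
    show "sat (nst M) (e(x := N.succ a)) E (Neg \<theta>)" if "sat (nst M) (e(x := a)) E (Neg \<theta>)" for a
    proof -
      have "a \<notin> Omega M" using inf that by auto
      then obtain m where "a = star M m" by (auto simp: Omega_def)
      then show ?thesis using none by (simp flip: star_succ)
    qed
  qed
  with inf \<open>\<omega> \<in> Omega M\<close> show False by simp
qed

lemma star_value_unique:
  "star_value M \<phi> e E a b c \<Longrightarrow> star_value M \<phi> e E a b d \<Longrightarrow> c = d"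
  unfolding star_value_iff by (rule N.Least_fm_unique)

text \<open>By transfer the standard value of the function satisfies the starred graph, so it bounds
  the least solution \<open>c\<close>; the end extension then makes \<open>c\<close>
  standard.\<close>

lemma star_value_standard:
  assumes "std_function M \<phi> e E" "star_value M \<phi> e E (star M n) (star M m) c"
  shows "c \<in> range (star M)"
proof -
  obtain k where k: "sat (std M) (e(0 := n, 1 := m, 2 := k)) E \<phi>"
    using assms(1) unfolding std_function_def by blast
  have "star M \<circ> e(0 := n, 1 := m, 2 := k) =
    (star M \<circ> e)(0 := star M n, 1 := star M m, 2 := star M k)"
    by auto
  with k assms(1) have "star_sat3 M \<phi> e E (star M n) (star M m) (star M k)"
    by (simp add: std_function_def transfer star_sat3_def)
  then have "c = star M k \<or> c \<sqsubset> star M k"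
    using assms(2) N.less_linear[of c "star M k"] by (auto simp: star_value_def)
  then show ?thesis by (auto elim: less_starE)
qed

text \<open>The fixed \<open>\<omega>\<close> serves to bound the quantifier over arguments, so that
  underspill applies with \<open>a\<close>, \<open>c\<close> and \<open>\<omega>\<close> as possibly
  nonstandard parameters.\<close>

lemma star_value_stable:
  assumes "std_function M \<phi> e E" "\<omega> \<in> Omega M"
    and V: "\<And>\<omega>. \<omega> \<in> Omega M \<Longrightarrow> star_value M \<phi> e E a \<omega> c"
  shows "\<exists>m. \<forall>j. \<not> j \<sqsubset> star M m \<longrightarrow> star_value M \<phi> e E a j c"
proof -
  let ?e = "\<lambda>k. ((star M \<circ> e) \<circ> unskip2)(0 := a, 1 := \<omega>, 2 := k, 3 := c)"
  let ?\<theta> = "constant_fm (rename_fm skip2 (Least_fm 2 \<phi>))"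
  have upd: "(?e undefined)(2 := k) = ?e k" for k
    by auto
  have sat: "sat (nst M) ((?e undefined)(2 := k)) (starS M \<circ> E) ?\<theta> \<longleftrightarrow>
    (\<forall>j. j \<sqsubset> \<omega> \<longrightarrow> \<not> j \<sqsubset> k \<longrightarrow> star_value M \<phi> e E a j c)" for k
    unfolding upd sat_constant_fm star_value_iff ..
  have "\<exists>m. sat (nst M) ((?e undefined)(2 := star M m)) (starS M \<circ> E) ?\<theta>"
  proof (rule underspill[OF _ assms(2)])
    show "(starS M \<circ> E) i \<in> fam (nst M)" for i
      using assms(1) starS_fam unfolding std_function_def by blast
    show "sat (nst M) ((?e undefined)(2 := \<omega>')) (starS M \<circ> E) ?\<theta>" if "\<omega>' \<in> Omega M" for \<omega>'
      unfolding sat using not_less_Omega[OF that] V by blast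
  qed
  then obtain m where "\<forall>j. j \<sqsubset> \<omega> \<longrightarrow> \<not> j \<sqsubset> star M m \<longrightarrow> star_value M \<phi> e E a j c"
    unfolding sat ..
  then show ?thesis
    using V not_less_Omega[OF assms(2)] by blast
qed

lemma std_function_modulus_fm:
  assumes "std_sets M E"
  shows "std_function M (modulus_fm \<phi>) (e \<circ> unskip2) E"
  unfolding std_function_def modulus_fm_def
proof (intro conjI allI)
  fix n m
  let ?\<theta> = "settled_fm (rename_fm skip2 (Least_fm 2 \<phi>))"
  have E: "\<And>i. E i \<in> fam (std M)" using assms by (simp add: std_sets_def)
  have "sat (std M) ((e \<circ> unskip2)(0 := n, 1 := m, 2 := m)) E ?\<theta>"
    unfolding sat_settled_fm using S.less_irrefl by blast
  from S.Delta0_least[OF E this] obtain k where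
    "sat (std M) ((e \<circ> unskip2)(0 := n, 1 := m, 2 := k)) E (Least_fm 2 ?\<theta>)"
    by (auto simp: sat_Least_fm)
  then show "\<exists>!k. sat (std M) ((e \<circ> unskip2)(0 := n, 1 := m, 2 := k)) E (Least_fm 2 ?\<theta>)"
    using S.Least_fm_unique by blast
qed (fact assms)

lemma modulus_fm_value:
  assumes f: "std_function M \<phi> e E" and \<omega>: "\<omega> \<in> Omega M"
    and inv: "Omega_invariant_function M \<phi> e E \<omega>"
  shows "\<exists>m0. (\<forall>\<omega>'\<in>Omega M. star_value M (modulus_fm \<phi>) (e \<circ> unskip2) E (star M n) \<omega>' (star M m0)) \<and>
    (\<forall>m m'. leq (nst M) (star M m0) m \<and> leq (nst M) (star M m0) m' \<longrightarrow>
      star_value_eq M \<phi> e E (star M n) m m')"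
proof -
  let ?V = "\<lambda>j. star_value M \<phi> e E (star M n) j"
  obtain c where "?V \<omega> c"
    using inv \<omega> unfolding Omega_invariant_function_def star_value_eq_def by blast
  then have V: "?V \<omega>' c" if "\<omega>' \<in> Omega M" for \<omega>'
    using inv that star_value_unique unfolding Omega_invariant_function_def star_value_eq_def by blast
  obtain m1 where m1: "\<And>j. \<not> j \<sqsubset> star M m1 \<Longrightarrow> ?V j c"
    using star_value_stable[OF f \<omega> V] by blast
  \<comment> \<open>The value \<open>c\<close> is already attained at the standard argument
    \<open>star M m1\<close>.\<close>
  obtain c0 where c: "c = star M c0"
    using star_value_standard[OF f m1] N.less_irrefl by blast
  let ?\<theta> = "settled_fm (rename_fm skip2 (Least_fm 2 \<phi>))"
  let ?sat = "\<lambda>\<omega> k. sat (nst M) (((star M \<circ> e) \<circ> unskip2)(0 := star M n, 1 := \<omega>, 2 := k)) (starS M \<circ> E)"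
  \<comment> \<open>For standard \<open>k\<close> the right side does not mention
    \<open>\<omega>'\<close>. The premise of \<open>settled_fm\<close> holds as \<open>k\<close> is
    standard, the witness can only be \<open>c\<close>, and \<open>c\<close> is below
    \<open>\<omega>'\<close> because it is standard.\<close>
  have settled: "?sat \<omega>' (star M k) ?\<theta> \<longleftrightarrow> (\<forall>j. \<not> j \<sqsubset> star M k \<longrightarrow> ?V j c)" (is "?l \<longleftrightarrow> ?r")
    if \<omega>': "\<omega>' \<in> Omega M" for \<omega>' k
  proof -
    have "?l \<longleftrightarrow> (\<exists>d. d \<sqsubset> \<omega>' \<and> ?V \<omega>' d \<and> (\<forall>j. j \<sqsubset> \<omega>' \<longrightarrow> \<not> j \<sqsubset> star M k \<longrightarrow> ?V j d))"
      unfolding sat_settled_fm star_value_iff using star_less_Omega[OF \<omega>'] by blast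
    also have "\<dots> \<longleftrightarrow> (\<forall>j. j \<sqsubset> \<omega>' \<longrightarrow> \<not> j \<sqsubset> star M k \<longrightarrow> ?V j c)"
      using V[OF \<omega>'] star_value_unique star_less_Omega[OF \<omega>', of c0] unfolding c by blast
    also have "\<dots> \<longleftrightarrow> ?r"
      using V not_less_Omega[OF \<omega>'] by blast
    finally show ?thesis .
  qed
  have E: "(starS M \<circ> E) i \<in> fam (nst M)" for i
    using f starS_fam unfolding std_function_def by blast
  have sat_m1: "?sat \<omega> (star M m1) ?\<theta>" using settled[OF \<omega>] m1 by blast
  obtain k where k: "?sat \<omega> k ?\<theta>" "\<And>j. j \<sqsubset> k \<Longrightarrow> \<not> ?sat \<omega> j ?\<theta>"
    using N.Delta0_least[OF E sat_m1] by blast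
  \<comment> \<open>The least point, found among all nonstandard numbers, is at most the standard
    \<open>star M m1\<close> and hence standard.\<close>
  have "k = star M m1 \<or> k \<sqsubset> star M m1"
    using k(2) sat_m1 N.less_linear by blast
  then obtain m0 where m0: "k = star M m0" by (auto elim: less_starE)
  \<comment> \<open>Competitors below \<open>star M m0\<close> are standard, so
    \<open>settled\<close> carries minimality over from \<open>\<omega>\<close> to
    \<open>\<omega>'\<close>.\<close>
  have "?sat \<omega>' (star M m0) ?\<theta> \<and> (\<forall>j. j \<sqsubset> star M m0 \<longrightarrow> \<not> ?sat \<omega>' j ?\<theta>)" if "\<omega>' \<in> Omega M" for \<omega>'
    using k settled[OF \<omega>] settled[OF that] unfolding m0 by (metis less_starE)
  then have "\<forall>\<omega>'\<in>Omega M. star_value M (modulus_fm \<phi>) (e \<circ> unskip2) E (star M n) \<omega>' (star M m0)"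
    by (simp add: star_value_iff sat_Least_fm modulus_fm_def comp_assoc)
  moreover have "?V j c" if "leq (nst M) (star M m0) j" for j
  proof -
    have "\<not> j \<sqsubset> star M m0"
      using that N.less_trans N.less_irrefl by (auto simp: leq_def)
    then show ?thesis using settled[OF \<omega>] k(1) m0 by blast
  qed
  ultimately show ?thesis unfolding star_value_eq_def by blast
qed

lemma modulus_exists:
  assumes f: "std_function M \<phi> e E" and \<omega>: "\<omega> \<in> Omega M"
    and inv: "Omega_invariant_function M \<phi> e E \<omega>"
  shows "\<exists>\<gamma> e' E'. std_function M \<gamma> e' E' \<and> Omega_invariant_function M \<gamma> e' E' \<omega> \<and>
    (\<forall>n. \<exists>m0. star_value M \<gamma> e' E' (star M n) \<omega> (star M m0) \<and>
      (\<forall>m m'. leq (nst M) (star M m0) m \<and> leq (nst M) (star M m0) m' \<longrightarrow>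
        star_value_eq M \<phi> e E (star M n) m m'))"
proof (intro exI conjI)
  show "std_function M (modulus_fm \<phi>) (e \<circ> unskip2) E"
    using f std_function_modulus_fm by (simp add: std_function_def)
  show "Omega_invariant_function M (modulus_fm \<phi>) (e \<circ> unskip2) E \<omega>"
    unfolding Omega_invariant_function_def star_value_eq_def
    using modulus_fm_value[OF assms] \<omega> by blast
  show "\<forall>n. \<exists>m0. star_value M (modulus_fm \<phi>) (e \<circ> unskip2) E (star M n) \<omega> (star M m0) \<and>
      (\<forall>m m'. leq (nst M) (star M m0) m \<and> leq (nst M) (star M m0) m' \<longrightarrow>
        star_value_eq M \<phi> e E (star M n) m m')"
    using modulus_fm_value[OF assms] \<omega> by blast
qed

end

section \<open>Characteristic functions\<close>

text \<open>Variable 2 now holds the truth value, whereas in \<open>\<psi>\<close> it may be a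
  parameter; hence the renaming.\<close>

definition char_fm :: "fm \<Rightarrow> fm" where
  "char_fm \<psi> = Conj (Neg (Conj (rename_fm skip2 \<psi>) (Neg (Eq (Var 2) One))))
     (Neg (Conj (Neg (rename_fm skip2 \<psi>)) (Neg (Eq (Var 2) Zero))))"

lemma sat_char_fm:
  "sat A ((e \<circ> unskip2)(0 := a, 1 := b, 2 := c)) E (char_fm \<psi>) \<longleftrightarrow>
   c = (if sat A (e(0 := a, 1 := b)) E \<psi> then one A else zero A)"
  unfolding char_fm_def sat.simps sat_rename_skip2 by auto

context nsa_model
begin

lemma std_function_char_fm: "std_sets M E \<Longrightarrow> std_function M (char_fm \<psi>) (e \<circ> unskip2) E"
  unfolding std_function_def sat_char_fm by simp

lemma star_value_char_fm:
  "star_value M (char_fm \<psi>) (e \<circ> unskip2) E a b c \<longleftrightarrow>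
   c = (if star_sat2 M \<psi> e E a b then one (nst M) else zero (nst M))"
  unfolding star_value_def star_sat3_def star_sat2_def comp_assoc[symmetric] sat_char_fm
  using N.less_irrefl by auto

lemma star_value_eq_char_fm:
  "star_value_eq M (char_fm \<psi>) (e \<circ> unskip2) E a b b' \<longleftrightarrow>
   (star_sat2 M \<psi> e E a b \<longleftrightarrow> star_sat2 M \<psi> e E a b')"
  unfolding star_value_eq_def star_value_char_fm using N.one_neq_zero by auto

end

theorem mainTheorem1:
  fixes M :: "('a, 'b) nsa_structure" and \<omega> :: 'b
  assumes "s_NSA M" and "\<omega> \<in> Omega M"
  shows
    "(\<forall>\<psi> e E. std_sets M E \<and> Omega_invariant M \<psi> e E \<omega> \<longrightarrow>
      (\<forall>n. \<exists>m0. \<forall>m m'. leq (nst M) (star M m0) m \<and> leq (nst M) (star M m0) m' \<longrightarrow>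
         (star_sat2 M \<psi> e E (star M n) m \<longleftrightarrow> star_sat2 M \<psi> e E (star M n) m')) \<and>
      (\<exists>\<gamma> e' E'. std_function M \<gamma> e' E' \<and> Omega_invariant_function M \<gamma> e' E' \<omega> \<and>
         (\<forall>n. \<exists>m0. star_value M \<gamma> e' E' (star M n) \<omega> (star M m0) \<and>
            (\<forall>m m'. leq (nst M) (star M m0) m \<and> leq (nst M) (star M m0) m' \<longrightarrow>
               (star_sat2 M \<psi> e E (star M n) m \<longleftrightarrow> star_sat2 M \<psi> e E (star M n) m'))))) \<and>
     (\<forall>\<phi> e E. std_function M \<phi> e E \<and> Omega_invariant_function M \<phi> e E \<omega> \<longrightarrow>
      (\<forall>n. \<exists>m0. \<forall>m m'. leq (nst M) (star M m0) m \<and> leq (nst M) (star M m0) m' \<longrightarrow>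
         star_value_eq M \<phi> e E (star M n) m m') \<and>
      (\<exists>\<gamma> e' E'. std_function M \<gamma> e' E' \<and> Omega_invariant_function M \<gamma> e' E' \<omega> \<and>
         (\<forall>n. \<exists>m0. star_value M \<gamma> e' E' (star M n) \<omega> (star M m0) \<and>
            (\<forall>m m'. leq (nst M) (star M m0) m \<and> leq (nst M) (star M m0) m' \<longrightarrow>
               star_value_eq M \<phi> e E (star M n) m m'))))"
proof -
  interpret nsa_model M using assms(1) by unfold_locales
  note funs = modulus_exists[OF _ assms(2)]
  have fms: "\<exists>\<gamma> e' E'. std_function M \<gamma> e' E' \<and> Omega_invariant_function M \<gamma> e' E' \<omega> \<and>
      (\<forall>n. \<exists>m0. star_value M \<gamma> e' E' (star M n) \<omega> (star M m0) \<and>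
        (\<forall>m m'. leq (nst M) (star M m0) m \<and> leq (nst M) (star M m0) m' \<longrightarrow>
          (star_sat2 M \<psi> e E (star M n) m \<longleftrightarrow> star_sat2 M \<psi> e E (star M n) m')))"
    if "std_sets M E" "Omega_invariant M \<psi> e E \<omega>" for \<psi> e E
    using funs[OF std_function_char_fm[OF that(1)], of \<psi> e] that(2)
    unfolding star_value_eq_char_fm Omega_invariant_def
      Omega_invariant_function_def[of M "char_fm \<psi>"] by blast
  \<comment> \<open>Bare existence of \<open>m0\<close> follows from the versions with a modulus by
    forgetting which function computes it.\<close>
  show ?thesis
    by (intro conjI allI impI; elim conjE; (drule (1) fms | drule (1) funs); blast)
qed

end
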